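(* If $\dot G$ is an $(n,r)$-SR2SE, then $\dot G\ltimes K_2$ is a $(2n,r+1)$-SR2SE. If moreover $\dot G$ is non-bipartite, then $\mathrm{bd}(\dot G)$ is a $(2n,r)$-SR2SE; otherwise (if $\dot G$ is bipartite) $\mathrm{bd}(\dot G)$ consists of two disjoint copies of $\dot G$.
   Context: A signed graph $\dot G=(G,\sigma)$ consists of a simple graph $G$ and $\sigma:E(G)\to\{1,-1\}$; its adjacency matrix $A_{\dot G}$ is that of $G$ with entries of negative edges replaced by $-1$; it is bipartite if $G$ is. A signed $(0,2)$-graph is a connected signed graph in which any two distinct vertices have $0$ or $2$ common neighbours; a signed rectagraph is a triangle-free one. An SR2SE is a signed rectagraph whose spectrum consists of exactly two distinct eigenvalues $\pm\lambda$; an $(n,r)$-SR2SE has $n$ vertices and is $r$-regular. The signed graph $\dot G\ltimes K_2$ has adjacency matrix $\begin{bmatrix} A_{\dot G} & I\\ I & -A_{\dot G}\end{bmatrix}$ (two copies of $\dot G$, one negated, with each vertex joined to its copy by a positive edge). The bipartite double $\mathrm{bd}(\dot G)$ is the signed graph with adjacency matrix $A_{\dot G}\otimes\begin{bmatrix}0&1\\1&0\end{bmatrix}$ (Kronecker product). *)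

theory Defs
  imports
    "Jordan_Normal_Form.Spectral_Radius"
    "Graph_Theory.Digraph_Component"
begin

text \<open>
  A simple graph is a finite loop-free symmetric digraph without parallel arcs, i.e. an edge
  \<open>{u, v}\<close> is represented by the two arcs \<open>(u, v)\<close> and \<open>(v, u)\<close>. The signature is a function on
  arcs that takes the same value on both arcs of an edge; its values on non-arcs are irrelevant.
\<close>

record 'a signed_graph =
  base :: "'a pair_pre_digraph"
  sgn_of :: "'a \<times> 'a \<Rightarrow> int"

abbreviation sverts :: "'a signed_graph \<Rightarrow> 'a set" where
  "sverts G \<equiv> pverts (base G)"

abbreviation sarcs :: "'a signed_graph \<Rightarrow> ('a \<times> 'a) set" where
  "sarcs G \<equiv> parcs (base G)"

definition signed_graph :: "'a signed_graph \<Rightarrow> bool" where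
  "signed_graph G \<longleftrightarrow> pair_graph (base G) \<and>
     (\<forall>(u, v) \<in> sarcs G. sgn_of G (u, v) \<in> {1, -1} \<and> sgn_of G (v, u) = sgn_of G (u, v))"

definition bipartite :: "'a signed_graph \<Rightarrow> bool" where
  "bipartite G \<longleftrightarrow> (\<exists>X Y. X \<union> Y = sverts G \<and> X \<inter> Y = {} \<and>
     (\<forall>(u, v) \<in> sarcs G. u \<in> X \<and> v \<in> Y \<or> u \<in> Y \<and> v \<in> X))"

definition common_neighbours :: "'a signed_graph \<Rightarrow> 'a \<Rightarrow> 'a \<Rightarrow> 'a set" where
  "common_neighbours G u v = {w \<in> sverts G. (u, w) \<in> sarcs G \<and> (v, w) \<in> sarcs G}"

definition signed_02_graph :: "'a signed_graph \<Rightarrow> bool" where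
  "signed_02_graph G \<longleftrightarrow> signed_graph G \<and> Digraph_Component.connected (with_proj (base G)) \<and>
     (\<forall>u \<in> sverts G. \<forall>v \<in> sverts G. u \<noteq> v \<longrightarrow> card (common_neighbours G u v) \<in> {0, 2})"

definition triangle_free :: "'a signed_graph \<Rightarrow> bool" where
  "triangle_free G \<longleftrightarrow>
     \<not> (\<exists>u v w. (u, v) \<in> sarcs G \<and> (v, w) \<in> sarcs G \<and> (w, u) \<in> sarcs G)"

definition signed_rectagraph :: "'a signed_graph \<Rightarrow> bool" where
  "signed_rectagraph G \<longleftrightarrow> signed_02_graph G \<and> triangle_free G"

definition regular :: "nat \<Rightarrow> 'a signed_graph \<Rightarrow> bool" where
  "regular r G \<longleftrightarrow> (\<forall>v \<in> sverts G. out_degree (with_proj (base G)) v = r)"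

definition adj :: "'a signed_graph \<Rightarrow> 'a \<Rightarrow> 'a \<Rightarrow> real" where
  "adj G u v = (if (u, v) \<in> sarcs G then of_int (sgn_of G (u, v)) else 0)"

definition enumerates :: "'a list \<Rightarrow> 'a set \<Rightarrow> bool" where
  "enumerates vs V \<longleftrightarrow> distinct vs \<and> set vs = V"

definition adjacency_matrix :: "'a list \<Rightarrow> 'a signed_graph \<Rightarrow> real mat" where
  "adjacency_matrix vs G = mat (length vs) (length vs) (\<lambda>(i, j). adj G (vs ! i) (vs ! j))"

text \<open>
  The set of distinct eigenvalues of the adjacency matrix. It does not depend on the chosen
  enumeration of the vertices (\<open>spectrum_adjacency_matrix\<close> below); the matrix is real symmetric, so
  real eigenvalues are all the eigenvalues.
\<close>

definition sspectrum :: "'a signed_graph \<Rightarrow> real set" where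
  "sspectrum G = spectrum (adjacency_matrix (SOME vs. enumerates vs (sverts G)) G)"

definition SR2SE :: "'a signed_graph \<Rightarrow> bool" where
  "SR2SE G \<longleftrightarrow> signed_rectagraph G \<and> (\<exists>l. l \<noteq> - l \<and> sspectrum G = {l, - l})"

definition nr_SR2SE :: "nat \<Rightarrow> nat \<Rightarrow> 'a signed_graph \<Rightarrow> bool" where
  "nr_SR2SE n r G \<longleftrightarrow> SR2SE G \<and> card (sverts G) = n \<and> regular r G"

text \<open>
  The constructions below live on \<open>sverts G \<times> UNIV\<close>, the Boolean selecting the copy. That they
  have the prescribed adjacency matrices is shown in \<open>adjacency_matrix_ltimes_K2\<close> and \<open>adjacency_matrix_bd\<close>.
\<close>

definition ltimes_K2 :: "'a signed_graph \<Rightarrow> ('a \<times> bool) signed_graph" where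
  "ltimes_K2 G = \<lparr>
     base = \<lparr> pverts = sverts G \<times> UNIV,
              parcs = {((u, i), (v, j)). i = j \<and> (u, v) \<in> sarcs G \<or>
                                         i \<noteq> j \<and> u = v \<and> u \<in> sverts G} \<rparr>,
     sgn_of = (\<lambda>((u, i), (v, j)).
        if i \<noteq> j then 1 else if i then - sgn_of G (u, v) else sgn_of G (u, v)) \<rparr>"

definition bd :: "'a signed_graph \<Rightarrow> ('a \<times> bool) signed_graph" where
  "bd G = \<lparr>
     base = \<lparr> pverts = sverts G \<times> UNIV,
              parcs = {((u, i), (v, j)). i \<noteq> j \<and> (u, v) \<in> sarcs G} \<rparr>,
     sgn_of = (\<lambda>((u, i), (v, j)). sgn_of G (u, v)) \<rparr>"

definition two_copies :: "'a signed_graph \<Rightarrow> ('a \<times> bool) signed_graph" where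
  "two_copies G = \<lparr>
     base = \<lparr> pverts = sverts G \<times> UNIV,
              parcs = {((u, i), (v, j)). i = j \<and> (u, v) \<in> sarcs G} \<rparr>,
     sgn_of = (\<lambda>((u, i), (v, j)). sgn_of G (u, v)) \<rparr>"

text \<open>Sign-preserving isomorphism (no switching involved).\<close>

definition sg_iso :: "'a signed_graph \<Rightarrow> 'b signed_graph \<Rightarrow> bool" where
  "sg_iso G H \<longleftrightarrow> (\<exists>f. bij_betw f (sverts G) (sverts H) \<and>
     (\<forall>u \<in> sverts G. \<forall>v \<in> sverts G.
        ((u, v) \<in> sarcs G \<longleftrightarrow> (f u, f v) \<in> sarcs H) \<and>
        ((u, v) \<in> sarcs G \<longrightarrow> sgn_of H (f u, f v) = sgn_of G (u, v))))"

lemma eigenvalue_adjacency_matrix_iff: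
  assumes vs: "enumerates vs V"
  shows "eigenvalue (adjacency_matrix vs G) k \<longleftrightarrow>
    (\<exists>x. (\<exists>v\<in>V. x v \<noteq> 0) \<and> (\<forall>u\<in>V. (\<Sum>v\<in>V. adj G u v * x v) = k * x u))"
proof -
  let ?n = "length vs"
  have d: "distinct vs" and s: "set vs = V" using vs by (auto simp: enumerates_def)
  have bij: "bij_betw (\<lambda>i. vs ! i) {0..<?n} V"
    using d s by (metis atLeast0LessThan bij_betw_nth)
  have row: "(adjacency_matrix vs G *\<^sub>v w) $ i = (\<Sum>j = 0..<?n. adj G (vs ! i) (vs ! j) * w $ j)"
    if "w \<in> carrier_vec ?n" "i < ?n" for w i
    using that by (auto simp: adjacency_matrix_def scalar_prod_def intro!: sum.cong)
  show ?thesis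
  proof
    assume "eigenvalue (adjacency_matrix vs G) k"
    then obtain w where w: "w \<in> carrier_vec ?n" "w \<noteq> 0\<^sub>v ?n" "adjacency_matrix vs G *\<^sub>v w = k \<cdot>\<^sub>v w"
      by (auto simp: eigenvalue_def eigenvector_def adjacency_matrix_def)
    define x where "x v = w $ (inv_into {0..<?n} (\<lambda>i. vs ! i) v)" for v
    have x: "x (vs ! i) = w $ i" if "i < ?n" for i
      using bij_betw_inv_into_left[OF bij, of i] that by (simp add: x_def)
    from w obtain i where i: "i < ?n" "w $ i \<noteq> 0"
      by (metis carrier_vecD eq_vecI index_zero_vec)
    have "(\<Sum>v\<in>V. adj G u v * x v) = k * x u" if "u \<in> V" for u
    proof -
      from that s obtain i where i: "i < ?n" "u = vs ! i" by (metis in_set_conv_nth)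
      have "(\<Sum>v\<in>V. adj G u v * x v) = (\<Sum>j = 0..<?n. adj G u (vs ! j) * x (vs ! j))"
        using sum.reindex_bij_betw[OF bij, of "\<lambda>v. adj G u v * x v"] by simp
      also have "\<dots> = (adjacency_matrix vs G *\<^sub>v w) $ i" using i w(1) by (simp add: row x)
      also have "\<dots> = k * x u" using i w by (simp add: x)
      finally show ?thesis .
    qed
    moreover have "\<exists>v\<in>V. x v \<noteq> 0" using i x s by (metis nth_mem)
    ultimately show "\<exists>x. (\<exists>v\<in>V. x v \<noteq> 0) \<and> (\<forall>u\<in>V. (\<Sum>v\<in>V. adj G u v * x v) = k * x u)"
      by blast
  next
    assume "\<exists>x. (\<exists>v\<in>V. x v \<noteq> 0) \<and> (\<forall>u\<in>V. (\<Sum>v\<in>V. adj G u v * x v) = k * x u)"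
    then obtain x v where x: "v \<in> V" "x v \<noteq> 0"
      "\<And>u. u \<in> V \<Longrightarrow> (\<Sum>v\<in>V. adj G u v * x v) = k * x u" by blast
    define w where "w = vec ?n (\<lambda>i. x (vs ! i))"
    have w: "w \<in> carrier_vec ?n" by (simp add: w_def)
    from x(1) s obtain i where i: "i < ?n" "v = vs ! i" by (metis in_set_conv_nth)
    have "w \<noteq> 0\<^sub>v ?n" using i x(2) by (metis index_vec index_zero_vec(1) w_def)
    moreover have "adjacency_matrix vs G *\<^sub>v w = k \<cdot>\<^sub>v w"
    proof (rule eq_vecI)
      fix i assume "i < dim_vec (k \<cdot>\<^sub>v w)"
      then have i: "i < ?n" by (simp add: w_def)
      have "(adjacency_matrix vs G *\<^sub>v w) $ i = (\<Sum>j = 0..<?n. adj G (vs ! i) (vs ! j) * x (vs ! j))"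
        using i w by (simp add: row w_def)
      also have "\<dots> = (\<Sum>v\<in>V. adj G (vs ! i) v * x v)"
        using sum.reindex_bij_betw[OF bij, of "\<lambda>v. adj G (vs ! i) v * x v"] by simp
      also have "\<dots> = (k \<cdot>\<^sub>v w) $ i" using i x(3)[of "vs ! i"] nth_mem[OF i] unfolding s by (simp add: w_def)
      finally show "(adjacency_matrix vs G *\<^sub>v w) $ i = (k \<cdot>\<^sub>v w) $ i" .
    qed (simp add: w_def adjacency_matrix_def)
    ultimately show "eigenvalue (adjacency_matrix vs G) k"
      using w by (auto simp: eigenvalue_def eigenvector_def adjacency_matrix_def)
  qed
qed

lemma spectrum_adjacency_matrix:
  assumes "enumerates vs (sverts G)"
  shows "spectrum (adjacency_matrix vs G) = sspectrum G"
proof -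
  have some: "enumerates (SOME vs. enumerates vs (sverts G)) (sverts G)"
    using assms by (rule someI)
  show ?thesis
    unfolding sspectrum_def spectrum_def
    by (simp only: eigenvalue_adjacency_matrix_iff[OF some] eigenvalue_adjacency_matrix_iff[OF assms]
        cong: Collect_cong)
qed

lemma adjacency_matrix_ltimes_K2:
  assumes "enumerates vs (sverts G)"
  defines "ws \<equiv> map (\<lambda>v. (v, False)) vs @ map (\<lambda>v. (v, True)) vs"
  shows "enumerates ws (sverts (ltimes_K2 G))"
    and "adjacency_matrix ws (ltimes_K2 G) =
      four_block_mat (adjacency_matrix vs G) (1\<^sub>m (length vs))
        (1\<^sub>m (length vs)) (- adjacency_matrix vs G)"
proof -
  show "enumerates ws (sverts (ltimes_K2 G))"
    using assms by (auto simp: enumerates_def ltimes_K2_def distinct_map inj_on_def)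
  have d: "distinct vs" and s: "set vs = sverts G" using assms by (auto simp: enumerates_def)
  have m: "vs ! i \<in> sverts G" if "i < length vs" for i
    using nth_mem[OF that] unfolding s .
  show "adjacency_matrix ws (ltimes_K2 G) =
      four_block_mat (adjacency_matrix vs G) (1\<^sub>m (length vs))
        (1\<^sub>m (length vs)) (- adjacency_matrix vs G)"
      (is "_ = ?B")
  proof (rule eq_matI)
    have w: "ws ! i = (if i < length vs then (vs ! i, False) else (vs ! (i - length vs), True))"
      if "i < length vs + length vs" for i
      using that by (auto simp: ws_def nth_append)
    have l: "length ws = length vs + length vs" by (simp add: ws_def)
    have a: "dim_row (adjacency_matrix vs G) = length vs" "dim_col (adjacency_matrix vs G) = length vs"
      by (simp_all add: adjacency_matrix_def)
    have e: "adjacency_matrix vs G $$ (i, j) = adj G (vs ! i) (vs ! j)"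
      if "i < length vs" "j < length vs" for i j
      using that by (simp add: adjacency_matrix_def)
    fix i j
    assume "i < dim_row ?B" and "j < dim_col ?B"
    then have ij: "i < length vs + length vs" "j < length vs + length vs"
      by (simp_all add: a)
    then have lhs: "adjacency_matrix ws (ltimes_K2 G) $$ (i, j) = adj (ltimes_K2 G) (ws ! i) (ws ! j)"
      by (simp add: adjacency_matrix_def l)
    show "adjacency_matrix ws (ltimes_K2 G) $$ (i, j) = ?B $$ (i, j)"
      unfolding lhs
    proof (cases "i < length vs"; cases "j < length vs")
    qed (use ij m nth_eq_iff_index_eq[OF d] in
        \<open>simp_all add: w a e index_mat_four_block adj_def ltimes_K2_def\<close>)
  qed (simp_all add: adjacency_matrix_def ws_def)
qed

text \<open>
  Kronecker product \<open>A \<otimes> B\<close>: row \<open>(i, i')\<close> has index \<open>i * dim_row B + i'\<close>, likewise for columns.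
\<close>

definition kronecker :: "real mat \<Rightarrow> real mat \<Rightarrow> real mat" where
  "kronecker A B = mat (dim_row A * dim_row B) (dim_col A * dim_col B)
     (\<lambda>(i, j). A $$ (i div dim_row B, j div dim_col B) * B $$ (i mod dim_row B, j mod dim_col B))"

lemma adjacency_matrix_bd:
  assumes "enumerates vs (sverts G)"
  defines "ws \<equiv> List.product vs [False, True]"
  shows "enumerates ws (sverts (bd G))"
    and "adjacency_matrix ws (bd G) =
      kronecker (adjacency_matrix vs G) (mat_of_rows_list 2 [[0, 1], [1, 0]])"
proof -
  show "enumerates ws (sverts (bd G))"
    using assms by (auto simp: enumerates_def bd_def distinct_product)
  have p: "ws ! i = (vs ! (i div 2), i mod 2 = 1)" if "i < length vs * 2" for i
  proof -
    have "i mod 2 = 0 \<or> i mod 2 = 1" by auto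
    then show ?thesis using that by (auto simp: ws_def product_nth numeral_2_eq_2)
  qed
  have b: "mat_of_rows_list 2 [[0, 1], [1, 0 :: real]] $$ (i mod 2, j mod 2) =
      (if (i mod 2 = 1) = (j mod 2 = 1) then 0 else 1)" for i j :: nat
  proof -
    have "i mod 2 = 0 \<or> i mod 2 = 1" "j mod 2 = 0 \<or> j mod 2 = 1" by auto
    then show ?thesis by (auto simp: mat_of_rows_list_def)
  qed
  have l: "length ws = length vs * 2" by (simp add: ws_def length_product)
  have dm: "dim_row (mat_of_rows_list 2 [[0, 1], [1, 0 :: real]]) = 2"
      "dim_col (mat_of_rows_list 2 [[0, 1], [1, 0 :: real]]) = 2"
    by (simp_all add: mat_of_rows_list_def)
  show "adjacency_matrix ws (bd G) =
      kronecker (adjacency_matrix vs G) (mat_of_rows_list 2 [[0, 1], [1, 0]])"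
  proof (rule eq_matI)
    fix i j
    assume "i < dim_row (kronecker (adjacency_matrix vs G) (mat_of_rows_list 2 [[0, 1], [1, 0]]))"
      and "j < dim_col (kronecker (adjacency_matrix vs G) (mat_of_rows_list 2 [[0, 1], [1, 0]]))"
    then have ij: "i < length vs * 2" "j < length vs * 2"
      by (simp_all add: kronecker_def dm adjacency_matrix_def)
    then have "i div 2 < length vs" "j div 2 < length vs" by auto
    with ij show "adjacency_matrix ws (bd G) $$ (i, j) =
        kronecker (adjacency_matrix vs G) (mat_of_rows_list 2 [[0, 1], [1, 0]]) $$ (i, j)"
      by (auto simp: kronecker_def dm b adjacency_matrix_def l p adj_def bd_def)
  qed (simp_all add: kronecker_def dm adjacency_matrix_def l)
qed

end

theory Submission
  imports Defs
begin

text \<open>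
  A real symmetric matrix \<open>A\<close> has spectrum contained in \<open>{l, -l}\<close> only if \<open>A\<^sup>2 = l\<^sup>2 I\<close>: after
  triangularisation \<open>A\<^sup>2 - l\<^sup>2 I\<close> becomes strictly upper triangular, so its square, whose trace is the
  sum of the squared entries of \<open>A\<^sup>2 - l\<^sup>2 I\<close>, has trace \<open>0\<close>. Conversely, a matrix with zero diagonal
  and \<open>A\<^sup>2 = m\<^sup>2 I\<close>, \<open>m \<noteq> 0\<close>, has spectrum exactly \<open>{m, -m}\<close>. The adjacency matrix of
  \<open>ltimes_K2 G\<close> squares to \<open>(l\<^sup>2 + 1) I\<close>, the negation of one copy cancelling the off-diagonal
  blocks, and that of \<open>bd G\<close> squares to \<open>l\<^sup>2 I\<close>.
\<close>

section \<open>Symmetric real matrices with two opposite eigenvalues\<close>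

lemma trace_mult_comm:
  fixes M N :: "'b :: comm_semiring_0 mat"
  assumes "M \<in> carrier_mat n n" "N \<in> carrier_mat n n"
  shows "(\<Sum>i<n. (M * N) $$ (i, i)) = (\<Sum>i<n. (N * M) $$ (i, i))"
proof -
  have "(\<Sum>i<n. (M * N) $$ (i, i)) = (\<Sum>i<n. \<Sum>j<n. M $$ (i, j) * N $$ (j, i))"
    using assms by (auto simp: scalar_prod_def atLeast0LessThan intro!: sum.cong)
  also have "\<dots> = (\<Sum>j<n. \<Sum>i<n. N $$ (j, i) * M $$ (i, j))"
    by (subst sum.swap) (simp add: mult.commute)
  also have "\<dots> = (\<Sum>i<n. (N * M) $$ (i, i))"
    using assms by (auto simp: scalar_prod_def atLeast0LessThan intro!: sum.cong)
  finally show ?thesis .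
qed

text \<open>In every summand with \<open>j\<close> different from \<open>i\<close>, one of the two
  factors lies below the diagonal.\<close>

lemma upper_triangular_mult_diag:
  fixes M N :: "'b :: semiring_0 mat"
  assumes "M \<in> carrier_mat n n" "N \<in> carrier_mat n n"
    and "upper_triangular M" "upper_triangular N" and i: "i < n"
  shows "(M * N) $$ (i, i) = M $$ (i, i) * N $$ (i, i)"
proof -
  have z: "M $$ (i, j) * N $$ (j, i) = 0" if "j < n" "j \<noteq> i" for j
    using that assms by (cases "j < i") (auto simp: upper_triangular_def)
  have "(M * N) $$ (i, i) = (\<Sum>j<n. M $$ (i, j) * N $$ (j, i))"
    using assms by (auto simp: scalar_prod_def atLeast0LessThan intro!: sum.cong)
  also have "\<dots> = (\<Sum>j<n. if j = i then M $$ (i, i) * N $$ (i, i) else 0)"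
    using z by (intro sum.cong) auto
  finally show ?thesis using i by simp
qed

lemma upper_triangular_mult:
  fixes M N :: "'b :: semiring_0 mat"
  assumes "M \<in> carrier_mat n n" "N \<in> carrier_mat n n"
    and "upper_triangular M" "upper_triangular N"
  shows "upper_triangular (M * N)"
proof (rule upper_triangularI)
  fix i j assume ij: "j < i" "i < dim_row (M * N)"
  have z: "M $$ (i, k) * N $$ (k, j) = 0" if "k < n" for k
    using that ij assms by (cases "k < i") (auto simp: upper_triangular_def)
  have "(M * N) $$ (i, j) = (\<Sum>k<n. M $$ (i, k) * N $$ (k, j))"
    using assms ij by (auto simp: scalar_prod_def atLeast0LessThan intro!: sum.cong)
  then show "(M * N) $$ (i, j) = 0" using z by simp
qed

text \<open>The Hermitian form of \<open>A\<close> at an eigenvector equals its own conjugate by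
  symmetry, and it is \<open>e\<close> times the positive squared norm. The lemma is needed because
  triangularisation takes place over the complex numbers, whereas \<open>spectrum\<close> of a real
  matrix only records real eigenvalues.\<close>

lemma real_symmetric_eigenvalue_real:
  fixes A :: "real mat"
  assumes A: "A \<in> carrier_mat n n" and sym: "\<And>i j. i < n \<Longrightarrow> j < n \<Longrightarrow> A $$ (i, j) = A $$ (j, i)"
    and e: "eigenvalue (map_mat complex_of_real A) e"
  shows "e \<in> \<real>"
proof -
  from e A obtain v where v: "v \<in> carrier_vec n" "v \<noteq> 0\<^sub>v n"
    "map_mat complex_of_real A *\<^sub>v v = e \<cdot>\<^sub>v v"
    by (auto simp: eigenvalue_def eigenvector_def)
  have row: "(\<Sum>j<n. of_real (A $$ (i, j)) * v $ j) = e * v $ i" if "i < n" for i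
  proof -
    have "(map_mat complex_of_real A *\<^sub>v v) $ i = (\<Sum>j<n. of_real (A $$ (i, j)) * v $ j)"
      using that A v(1) by (auto simp: scalar_prod_def atLeast0LessThan intro!: sum.cong)
    then show ?thesis using v that by simp
  qed
  define N where "N = (\<Sum>i<n. (cmod (v $ i))\<^sup>2)"
  define s where "s = (\<Sum>i<n. \<Sum>j<n. of_real (A $$ (i, j)) * (cnj (v $ i) * v $ j))"
  have "s = (\<Sum>i<n. cnj (v $ i) * (\<Sum>j<n. of_real (A $$ (i, j)) * v $ j))"
    by (simp add: s_def sum_distrib_left mult_ac)
  also have "\<dots> = (\<Sum>i<n. e * of_real ((cmod (v $ i))\<^sup>2))"
    by (rule sum.cong[OF refl]) (simp add: row complex_norm_square del: of_real_power)
  also have "\<dots> = e * of_real N" by (simp add: N_def sum_distrib_left)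
  finally have sN: "s = e * of_real N" .
  have "cnj s = (\<Sum>j<n. \<Sum>i<n. of_real (A $$ (i, j)) * (cnj (v $ j) * v $ i))"
    unfolding s_def by (subst sum.swap) (simp add: mult_ac)
  also have "\<dots> = s" unfolding s_def by (intro sum.cong refl) (simp add: sym)
  finally have "cnj s = s" .
  moreover from v obtain i where i: "i < n" "v $ i \<noteq> 0"
    by (metis carrier_vecD eq_vecI index_zero_vec)
  have "0 < N" unfolding N_def by (rule sum_pos2[of _ i]) (use i in auto)
  ultimately have "cnj e = e" using sN by simp
  then show ?thesis by (simp add: Reals_cnj_iff)
qed

lemma symmetric_spectrum_pm_imp_square:
  fixes A :: "real mat"
  assumes A: "A \<in> carrier_mat n n" and sym: "\<And>i j. i < n \<Longrightarrow> j < n \<Longrightarrow> A $$ (i, j) = A $$ (j, i)"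
    and spec: "spectrum A \<subseteq> {l, - l}"
  shows "A * A = l\<^sup>2 \<cdot>\<^sub>m 1\<^sub>m n"
proof -
  let ?c = "map_mat complex_of_real"
  have Ac: "?c A \<in> carrier_mat n n" using A by simp
  \<comment> \<open>Over the complex numbers the characteristic polynomial splits, as the Schur
    decomposition requires.\<close>
  from char_poly_factorized[OF Ac] obtain es
    where es: "char_poly (?c A) = (\<Prod>a\<leftarrow>es. [:- a, 1:])" by auto
  obtain B P Q where BPQ: "schur_decomposition (?c A) es = (B, P, Q)" by (metis prod_cases3)
  from schur_decomposition[OF Ac es BPQ]
  have sim: "similar_mat_wit (?c A) B P Q" and ut: "upper_triangular B" and dB: "diag_mat B = es" by auto
  from similar_mat_witD2[OF Ac sim]
  have PQ: "P * Q = 1\<^sub>m n" "Q * P = 1\<^sub>m n" and AB: "?c A = P * B * Q"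
    and B: "B \<in> carrier_mat n n" and P: "P \<in> carrier_mat n n" and Q: "Q \<in> carrier_mat n n" by auto
  \<comment> \<open>The diagonal of \<open>B\<close> consists of complex eigenvalues of
    \<open>A\<close>. Being real, they are roots of the real characteristic polynomial, so the
    hypothesis on the real spectrum applies to them.\<close>
  have sq: "(B $$ (i, i))\<^sup>2 = of_real (l\<^sup>2)" if "i < n" for i
  proof -
    have "B $$ (i, i) \<in> set es" using that B by (auto simp: dB[symmetric] diag_mat_def)
    then have root: "poly (char_poly (?c A)) (B $$ (i, i)) = 0"
      by (auto simp: es poly_prod_list prod_list_zero_iff)
    then have "eigenvalue (?c A) (B $$ (i, i))" using eigenvalue_root_char_poly[OF Ac] by simp
    from real_symmetric_eigenvalue_real[OF A sym this] obtain a where a: "B $$ (i, i) = of_real a"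
      by (auto elim: Reals_cases)
    have "of_real (poly (char_poly A) a) = (0::complex)"
      using root unfolding of_real_hom.char_poly_hom[OF A] a by simp
    then have "eigenvalue A a" using eigenvalue_root_char_poly[OF A] by simp
    then have "a = l \<or> a = - l" using spec by (auto simp: spectrum_def)
    then show ?thesis by (auto simp: a)
  qed
  define D where "D = A * A - l\<^sup>2 \<cdot>\<^sub>m 1\<^sub>m n"
  have D: "D \<in> carrier_mat n n" by (simp add: D_def minus_carrier_mat)
  \<comment> \<open>\<open>C\<close> is the triangular counterpart of \<open>D\<close>: conjugation
    by \<open>P\<close> takes one to the other, and by \<open>sq\<close> the diagonal of
    \<open>C\<close> vanishes.\<close>
  define C where "C = B * B - of_real (l\<^sup>2) \<cdot>\<^sub>m 1\<^sub>m n"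
  have C: "C \<in> carrier_mat n n" by (simp add: C_def minus_carrier_mat)
  have utC: "upper_triangular C"
    using upper_triangular_mult[OF B B ut ut] B by (auto simp: C_def upper_triangular_def)
  have dC: "C $$ (i, i) = 0" if "i < n" for i
    using that B upper_triangular_mult_diag[OF B B ut ut that] sq[OF that]
    by (simp add: C_def power2_eq_square)
  have "?c D = ?c A * ?c A - of_real (l\<^sup>2) \<cdot>\<^sub>m 1\<^sub>m n"
  proof (rule eq_matI)
    fix i j assume "i < dim_row (?c A * ?c A - of_real (l\<^sup>2) \<cdot>\<^sub>m 1\<^sub>m n)"
      "j < dim_col (?c A * ?c A - of_real (l\<^sup>2) \<cdot>\<^sub>m 1\<^sub>m n)"
    then show "?c D $$ (i, j) = (?c A * ?c A - of_real (l\<^sup>2) \<cdot>\<^sub>m 1\<^sub>m n) $$ (i, j)"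
      using A by (simp add: D_def scalar_prod_def)
  qed (use A in \<open>simp_all add: D_def\<close>)
  also have "?c A * ?c A = P * (B * B) * Q"
  proof -
    have "?c A * ?c A = P * B * (Q * P) * B * Q"
      unfolding AB using P Q B by (simp add: assoc_mult_mat[of _ n n _ n _ n])
    then show ?thesis using P Q B by (simp add: PQ assoc_mult_mat[of _ n n _ n _ n])
  qed
  \<comment> \<open>The scalar matrix is also written as a conjugate by \<open>P\<close>, so that
    the difference of the two terms becomes \<open>P * C * Q\<close>.\<close>
  also have "of_real (l\<^sup>2) \<cdot>\<^sub>m 1\<^sub>m n = P * (of_real (l\<^sup>2) \<cdot>\<^sub>m 1\<^sub>m n) * Q"
    using P Q PQ by (simp add: mult_smult_distrib[of _ n n _ n] mult_smult_assoc_mat[of _ n n _ n])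
  also have "P * (B * B) * Q - P * (of_real (l\<^sup>2) \<cdot>\<^sub>m 1\<^sub>m n) * Q = P * C * Q"
    unfolding C_def using P Q B
    by (simp add: mult_minus_distrib_mat[of _ n n _ n] minus_mult_distrib_mat[of _ n n _ _ n])
  finally have DC: "?c D = P * C * Q" .
  have "(\<Sum>i<n. (?c D * ?c D) $$ (i, i)) = (\<Sum>i<n. (P * (C * C * Q)) $$ (i, i))"
  proof -
    have "?c D * ?c D = P * C * (Q * P) * C * Q"
      unfolding DC using P Q C by (simp add: assoc_mult_mat[of _ n n _ n _ n])
    also have "\<dots> = P * (C * C * Q)" using P Q C by (simp add: PQ assoc_mult_mat[of _ n n _ n _ n])
    finally show ?thesis by simp
  qed
  \<comment> \<open>Moving \<open>P\<close> to the end of the product cancels it against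
    \<open>Q\<close>.\<close>
  also have "\<dots> = (\<Sum>i<n. (C * C * Q * P) $$ (i, i))"
    using P Q C by (intro trace_mult_comm) auto
  also have "C * C * Q * P = C * C"
    using P Q C by (simp add: PQ assoc_mult_mat[of _ n n _ n _ n])
  also have "(\<Sum>i<n. (C * C) $$ (i, i)) = 0"
    by (simp add: upper_triangular_mult_diag[OF C C utC utC] dC)
  finally have tr: "(\<Sum>i<n. (?c D * ?c D) $$ (i, i)) = 0" .
  have symD: "D $$ (i, j) = D $$ (j, i)" if "i < n" "j < n" for i j
    using that A sym by (auto simp: D_def scalar_prod_def mult.commute intro!: sum.cong)
  \<comment> \<open>By symmetry of \<open>D\<close>, the trace of its square is a sum of real
    squares; since it is zero, every entry of \<open>D\<close> is zero.\<close>
  have "(\<Sum>i<n. (?c D * ?c D) $$ (i, i)) = (\<Sum>i<n. \<Sum>j<n. of_real ((D $$ (i, j))\<^sup>2))"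
  proof (intro sum.cong refl)
    fix i assume "i \<in> {..<n}"
    then have i: "i < n" by simp
    then have "(?c D * ?c D) $$ (i, i) = (\<Sum>j<n. of_real (D $$ (i, j)) * of_real (D $$ (j, i)))"
      using D by (simp add: scalar_prod_def atLeast0LessThan)
    also have "\<dots> = (\<Sum>j<n. of_real ((D $$ (i, j))\<^sup>2))"
      using i by (intro sum.cong refl) (simp add: symD[of i] power2_eq_square)
    finally show "(?c D * ?c D) $$ (i, i) = (\<Sum>j<n. of_real ((D $$ (i, j))\<^sup>2))" .
  qed
  also have "\<dots> = of_real (\<Sum>i<n. \<Sum>j<n. (D $$ (i, j))\<^sup>2)" by simp
  finally have "(\<Sum>i<n. \<Sum>j<n. (D $$ (i, j))\<^sup>2) = 0" using tr by (simp only: of_real_eq_0_iff eq_commute[of "0 :: complex"])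
  then have D0: "D $$ (i, j) = 0" if "i < n" "j < n" for i j
    using that by (simp add: sum_nonneg_eq_0_iff sum_nonneg)
  show ?thesis
  proof (rule eq_matI)
    fix i j assume "i < dim_row (l\<^sup>2 \<cdot>\<^sub>m 1\<^sub>m n)" "j < dim_col (l\<^sup>2 \<cdot>\<^sub>m 1\<^sub>m n)"
    then have ij: "i < n" "j < n" by simp_all
    then have "D $$ (i, j) = (A * A) $$ (i, j) - (l\<^sup>2 \<cdot>\<^sub>m 1\<^sub>m n) $$ (i, j)"
      unfolding D_def by (intro index_minus_mat) simp_all
    then show "(A * A) $$ (i, j) = (l\<^sup>2 \<cdot>\<^sub>m 1\<^sub>m n) $$ (i, j)"
      using D0[OF ij] by simp
  qed (use A in simp_all)
qed

section \<open>Spectra in terms of sums over vertices\<close>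

lemma mem_sspectrum_iff:
  assumes "finite (sverts G)"
  shows "k \<in> sspectrum G \<longleftrightarrow> (\<exists>x. (\<exists>v\<in>sverts G. x v \<noteq> 0) \<and>
    (\<forall>u\<in>sverts G. (\<Sum>v\<in>sverts G. adj G u v * x v) = k * x u))"
proof -
  obtain vs where "enumerates vs (sverts G)"
    using finite_distinct_list[OF assms] by (auto simp: enumerates_def)
  then show ?thesis
    by (simp add: spectrum_adjacency_matrix[symmetric] spectrum_def eigenvalue_adjacency_matrix_iff)
qed

text \<open>The matrix identity is transferred to sums over vertices, so that the two constructions
  can be treated without choosing an enumeration.\<close>

lemma sspectrum_pm_imp_adj_square:
  assumes fin: "finite (sverts G)" and sym: "\<And>u v. adj G u v = adj G v u"
    and spec: "sspectrum G \<subseteq> {l, - l}" and uv: "u \<in> sverts G" "v \<in> sverts G"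
  shows "(\<Sum>w\<in>sverts G. adj G u w * adj G w v) = (if u = v then l\<^sup>2 else 0)"
proof -
  obtain vs where vs: "distinct vs" "set vs = sverts G"
    using finite_distinct_list[OF fin] by auto
  let ?n = "length vs" and ?A = "adjacency_matrix vs G"
  have A: "?A \<in> carrier_mat ?n ?n" by (simp add: adjacency_matrix_def)
  have "spectrum ?A = sspectrum G"
    by (rule spectrum_adjacency_matrix) (simp add: enumerates_def vs)
  then have sq: "?A * ?A = l\<^sup>2 \<cdot>\<^sub>m 1\<^sub>m ?n"
    by (intro symmetric_spectrum_pm_imp_square[OF A])
      (use spec in \<open>simp_all add: adjacency_matrix_def sym\<close>)
  obtain i j where ij: "i < ?n" "j < ?n" "u = vs ! i" "v = vs ! j"
    using uv vs(2) by (metis in_set_conv_nth)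
  have bij: "bij_betw (\<lambda>i. vs ! i) {..<?n} (sverts G)"
    using vs by (metis bij_betw_nth)
  have "(\<Sum>w\<in>sverts G. adj G u w * adj G w v) = (\<Sum>k<?n. adj G u (vs ! k) * adj G (vs ! k) v)"
    by (rule sum.reindex_bij_betw[OF bij, symmetric])
  also have "\<dots> = (?A * ?A) $$ (i, j)"
    using ij by (auto simp: adjacency_matrix_def scalar_prod_def atLeast0LessThan intro!: sum.cong)
  also have "\<dots> = (if u = v then l\<^sup>2 else 0)"
    using ij vs(1) by (simp add: sq nth_eq_iff_index_eq)
  finally show ?thesis .
qed

text \<open>Applying the adjacency operator twice to an eigenvector forces the squares of
  \<open>k\<close> and \<open>m\<close> to agree. Both signs occur: the zero diagonal prevents the
  operator from being scalar, so the column used as an eigenvector does not vanish.\<close>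

lemma adj_square_imp_sspectrum:
  assumes fin: "finite (sverts G)" and ne: "sverts G \<noteq> {}" and diag: "\<And>u. adj G u u = 0"
    and m: "m \<noteq> 0"
    and sq: "\<And>u v. u \<in> sverts G \<Longrightarrow> v \<in> sverts G \<Longrightarrow>
      (\<Sum>w\<in>sverts G. adj G u w * adj G w v) = (if u = v then m\<^sup>2 else 0)"
  shows "sspectrum G = {m, - m}"
proof (intro equalityI subsetI)
  let ?V = "sverts G"
  fix k assume "k \<in> sspectrum G"
  then obtain x u where u: "u \<in> ?V" "x u \<noteq> 0"
    and x: "\<And>u. u \<in> ?V \<Longrightarrow> (\<Sum>v\<in>?V. adj G u v * x v) = k * x u"
    by (auto simp: mem_sspectrum_iff[OF fin])
  have "k\<^sup>2 * x u = (\<Sum>w\<in>?V. adj G u w * (k * x w))"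
    using x[OF u(1), symmetric] by (simp add: power2_eq_square sum_distrib_left mult_ac)
  also have "\<dots> = (\<Sum>w\<in>?V. \<Sum>v\<in>?V. adj G u w * adj G w v * x v)"
    by (simp add: x[symmetric] sum_distrib_left mult_ac)
  also have "\<dots> = (\<Sum>v\<in>?V. (\<Sum>w\<in>?V. adj G u w * adj G w v) * x v)"
    by (subst sum.swap) (simp add: sum_distrib_right)
  also have "\<dots> = (\<Sum>v\<in>?V. if u = v then m\<^sup>2 * x v else 0)"
    using u by (intro sum.cong) (auto simp: sq)
  also have "\<dots> = m\<^sup>2 * x u" using fin u by simp
  finally have "k\<^sup>2 = m\<^sup>2" using u by simp
  then show "k \<in> {m, - m}" by (simp add: power2_eq_iff)
next
  let ?V = "sverts G"
  fix k assume "k \<in> {m, - m}"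
  then have k: "k\<^sup>2 = m\<^sup>2" "k \<noteq> 0" using m by auto
  obtain u0 where u0: "u0 \<in> ?V" using ne by auto
  define x where "x v = adj G v u0 + (if v = u0 then k else 0)" for v
    \<comment> \<open>the column of \<open>A + k I\<close> at \<open>u0\<close>; it is killed by \<open>A - k I\<close> because \<open>A\<^sup>2 = k\<^sup>2 I\<close>\<close>
  have "(\<Sum>v\<in>?V. adj G u v * x v) = k * x u" if u: "u \<in> ?V" for u
  proof -
    have "(\<Sum>v\<in>?V. adj G u v * x v) =
        (\<Sum>v\<in>?V. adj G u v * adj G v u0) + (\<Sum>v\<in>?V. if v = u0 then adj G u v * k else 0)"
      unfolding sum.distrib[symmetric] by (rule sum.cong) (auto simp: x_def algebra_simps)
    also have "\<dots> = (if u = u0 then m\<^sup>2 else 0) + adj G u u0 * k"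
      using fin u u0 by (simp add: sq)
    also have "\<dots> = k * x u"
      using k(1) by (auto simp: x_def power2_eq_square distrib_left mult.commute)
    finally show ?thesis .
  qed
  moreover have "x u0 \<noteq> 0" using k by (simp add: x_def diag)
  ultimately show "k \<in> sspectrum G" using u0 by (auto simp: mem_sspectrum_iff[OF fin])
qed

section \<open>Set-theoretic forms of the graph notions\<close>

lemma pair_graph_iff:
  "pair_graph H \<longleftrightarrow> finite (pverts H) \<and> parcs H \<subseteq> pverts H \<times> pverts H \<and> sym (parcs H) \<and> irrefl (parcs H)"
  (is "?L \<longleftrightarrow> ?R")
proof
  assume ?L
  then interpret pair_graph H .
  show ?R
    using pair_sym_arcs pair_no_loops
    by (fastforce simp: symmetric_def irrefl_def dest: in_arcsD1 in_arcsD2)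
next
  assume R: ?R
  then have "finite (parcs H)" by (meson finite_SigmaI finite_subset)
  with R show ?L
    by unfold_locales (auto simp: symmetric_def irrefl_def)
qed

text \<open>The set reachable from a vertex is closed under arcs, and a closed set contains whatever
  is reachable from its members. This form suits the doubled graphs, whose closed sets yield closed
  sets of \<open>G\<close> layer by layer.\<close>

lemma connected_iff_closed:
  assumes "pair_graph H"
  shows "Digraph_Component.connected (with_proj H) \<longleftrightarrow> pverts H \<noteq> {} \<and>
    (\<forall>S. S \<subseteq> pverts H \<longrightarrow> S \<noteq> {} \<longrightarrow> (\<forall>u v. (u, v) \<in> parcs H \<longrightarrow> u \<in> S \<longrightarrow> v \<in> S) \<longrightarrow> S = pverts H)"
  (is "_ \<longleftrightarrow> _ \<and> ?R")
proof -
  interpret pair_graph H by fact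
  \<comment> \<open>Connectedness means reachability along the symmetric closure, which adds no arc
    here.\<close>
  have s: "(parcs H)\<^sup>s = parcs H"
    using arcs_symmetric by (auto simp: symcl_def)
  have "(\<forall>u\<in>pverts H. \<forall>v\<in>pverts H. (u, v) \<in> rtrancl_on (pverts H) (parcs H)) \<longleftrightarrow> ?R"
    (is "?C \<longleftrightarrow> _")
  proof
    assume C: ?C
    show ?R
    proof (intro allI impI)
      fix S assume S: "S \<subseteq> pverts H" "S \<noteq> {}" "\<forall>u v. (u, v) \<in> parcs H \<longrightarrow> u \<in> S \<longrightarrow> v \<in> S"
      then obtain u where u: "u \<in> S" by auto
      have "v \<in> S" if "(u, v) \<in> rtrancl_on (pverts H) (parcs H)" for v
        using that by (induct rule: rtrancl_on_induct) (use u S in auto)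
      then show "S = pverts H" using C S u by blast
    qed
  next
    assume R: ?R
    show ?C
    proof
      fix u assume u: "u \<in> pverts H"
      have "{v \<in> pverts H. (u, v) \<in> rtrancl_on (pverts H) (parcs H)} = pverts H"
        by (rule R[rule_format])
          (use u in \<open>auto intro: rtrancl_on_into_rtrancl_on dest: in_arcsD1 in_arcsD2\<close>)
      then show "\<forall>v\<in>pverts H. (u, v) \<in> rtrancl_on (pverts H) (parcs H)" by auto
    qed
  qed
  then show ?thesis by (simp add: connected_conv s)
qed

lemma out_degree_with_proj: "out_degree (with_proj H) v = card {w. (v, w) \<in> parcs H}"
proof -
  have "out_arcs (with_proj H) v = Pair v ` {w. (v, w) \<in> parcs H}"
    by (auto simp: out_arcs_def)
  then show ?thesis by (simp add: out_degree_def card_image inj_on_def)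
qed

lemma signed_graphD:
  assumes "signed_graph G"
  shows "finite (sverts G)" "(u, v) \<in> sarcs G \<Longrightarrow> u \<in> sverts G \<and> v \<in> sverts G"
    "(u, v) \<in> sarcs G \<longleftrightarrow> (v, u) \<in> sarcs G" "(u, u) \<notin> sarcs G"
    "(u, v) \<in> sarcs G \<Longrightarrow> sgn_of G (u, v) \<in> {1, -1} \<and> sgn_of G (v, u) = sgn_of G (u, v)"
  using assms by (auto simp: signed_graph_def pair_graph_iff irrefl_def dest: symD)

lemma adj_sym: "signed_graph G \<Longrightarrow> adj G u v = adj G v u"
  by (auto simp: adj_def signed_graphD(3,5))

lemma adj_diag: "signed_graph G \<Longrightarrow> adj G u u = 0"
  by (simp add: adj_def signed_graphD(4))

section \<open>The two constructions as signed graphs\<close>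

lemma sverts_ltimes_K2: "sverts (ltimes_K2 G) = sverts G \<times> UNIV"
  by (simp add: ltimes_K2_def)

lemma sarcs_ltimes_K2:
  "((u, i), (v, j)) \<in> sarcs (ltimes_K2 G) \<longleftrightarrow>
    i = j \<and> (u, v) \<in> sarcs G \<or> i \<noteq> j \<and> u = v \<and> u \<in> sverts G"
  by (simp add: ltimes_K2_def)

lemma sverts_bd: "sverts (bd G) = sverts G \<times> UNIV"
  by (simp add: bd_def)

lemma sarcs_bd: "((u, i), (v, j)) \<in> sarcs (bd G) \<longleftrightarrow> i \<noteq> j \<and> (u, v) \<in> sarcs G"
  by (simp add: bd_def)

lemma adj_ltimes_K2:
  assumes "u \<in> sverts G"
  shows "adj (ltimes_K2 G) (u, i) (v, j) =
    (if i = j then if i then - adj G u v else adj G u v else if u = v then 1 else 0)"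
  using assms by (simp add: adj_def ltimes_K2_def)

lemma adj_bd: "adj (bd G) (u, i) (v, j) = (if i = j then 0 else adj G u v)"
  by (simp add: adj_def bd_def)

lemma signed_graph_ltimes_K2:
  assumes "signed_graph G"
  shows "signed_graph (ltimes_K2 G)"
proof -
  have "pair_graph (base (ltimes_K2 G))"
    unfolding pair_graph_iff
    using signed_graphD(1,4)[OF assms]
    by (auto simp: sverts_ltimes_K2 sarcs_ltimes_K2 sym_def irrefl_def
      dest: signed_graphD(2)[OF assms] signed_graphD(3)[OF assms, THEN iffD1])
  moreover have "sgn_of (ltimes_K2 G) (p, q) \<in> {1, -1} \<and>
      sgn_of (ltimes_K2 G) (q, p) = sgn_of (ltimes_K2 G) (p, q)"
    if "(p, q) \<in> sarcs (ltimes_K2 G)" for p q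
    using that signed_graphD(5)[OF assms, of "fst p" "fst q"]
    by (cases p; cases q) (auto simp: ltimes_K2_def)
  ultimately show ?thesis by (auto simp: signed_graph_def)
qed

lemma signed_graph_bd:
  assumes "signed_graph G"
  shows "signed_graph (bd G)"
proof -
  have "pair_graph (base (bd G))"
    unfolding pair_graph_iff
    using signed_graphD(1,4)[OF assms]
    by (auto simp: sverts_bd sarcs_bd sym_def irrefl_def
      dest: signed_graphD(2)[OF assms] signed_graphD(3)[OF assms, THEN iffD1])
  moreover have "sgn_of (bd G) (p, q) \<in> {1, -1} \<and> sgn_of (bd G) (q, p) = sgn_of (bd G) (p, q)"
    if "(p, q) \<in> sarcs (bd G)" for p q
    using that signed_graphD(5)[OF assms, of "fst p" "fst q"]
    by (cases p; cases q) (auto simp: bd_def)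
  ultimately show ?thesis by (auto simp: signed_graph_def)
qed

section \<open>Connectedness of the constructions\<close>

text \<open>One layer of a nonempty closed set is nonempty and closed in \<open>G\<close>, hence
  contains all vertices; the arcs joining the copies then fill the other layer.\<close>

lemma connected_ltimes_K2:
  assumes G: "signed_graph G" and conn: "Digraph_Component.connected (with_proj (base G))"
  shows "Digraph_Component.connected (with_proj (base (ltimes_K2 G)))"
proof -
  have pg: "pair_graph (base G)" "pair_graph (base (ltimes_K2 G))"
    using G signed_graph_ltimes_K2[OF G] by (auto simp: signed_graph_def)
  note closed = conn[unfolded connected_iff_closed[OF pg(1)]]
  have "S = sverts (ltimes_K2 G)"
    if S: "S \<subseteq> sverts (ltimes_K2 G)" "S \<noteq> {}"
      and arc: "\<And>p q. (p, q) \<in> sarcs (ltimes_K2 G) \<Longrightarrow> p \<in> S \<Longrightarrow> q \<in> S" for S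
  proof -
    obtain u i where ui: "(u, i) \<in> S" using S by auto
    have "(w, i) \<in> S" if "(v, w) \<in> sarcs G" "(v, i) \<in> S" for v w
      using that arc[of "(v, i)" "(w, i)"] by (simp add: sarcs_ltimes_K2)
    then have "{v. (v, i) \<in> S} = sverts G"
      by (intro closed[THEN conjunct2, rule_format])
        (use S ui in \<open>auto simp: sverts_ltimes_K2\<close>)
    then have "(v, j) \<in> S" if "v \<in> sverts G" for v j
      using that arc[of "(v, i)" "(v, j)"] by (cases "i = j") (auto simp: sarcs_ltimes_K2)
    then show ?thesis using S by (auto simp: sverts_ltimes_K2)
  qed
  then show ?thesis
    unfolding connected_iff_closed[OF pg(2)] using closed by (auto simp: sverts_ltimes_K2)
qed

text \<open>If a proper closed set met no vertex twice, its two layers would be a bipartition of \<open>G\<close>.\<close>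

lemma connected_bd:
  assumes G: "signed_graph G" and conn: "Digraph_Component.connected (with_proj (base G))"
    and nb: "\<not> bipartite G"
  shows "Digraph_Component.connected (with_proj (base (bd G)))"
proof -
  have pg: "pair_graph (base G)" "pair_graph (base (bd G))"
    using G signed_graph_bd[OF G] by (auto simp: signed_graph_def)
  note closed = conn[unfolded connected_iff_closed[OF pg(1)]]
  have "S = sverts (bd G)"
    if S: "S \<subseteq> sverts (bd G)" "S \<noteq> {}"
      and arc: "\<And>p q. (p, q) \<in> sarcs (bd G) \<Longrightarrow> p \<in> S \<Longrightarrow> q \<in> S" for S
  proof -
    let ?X = "{v. (v, False) \<in> S}" and ?Y = "{v. (v, True) \<in> S}"
    have step: "(v, \<not> i) \<in> S" if "(u, v) \<in> sarcs G" "(u, i) \<in> S" for u v i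
      using that arc[of "(u, i)" "(v, \<not> i)"] by (simp add: sarcs_bd)
    have V: "u \<in> sverts G" if "(u, i) \<in> S" for u i using that S by (auto simp: sverts_bd)
    \<comment> \<open>Arcs of \<open>bd G\<close> swap the layers, so an arc of \<open>G\<close>
      leads from \<open>?X\<close> into \<open>?Y\<close> and from \<open>?Y\<close> into
      \<open>?X\<close>. Hence the union, and later the intersection, is closed in
      \<open>G\<close>.\<close>
    have un: "?X \<union> ?Y = sverts G"
    proof (rule closed[THEN conjunct2, rule_format])
      show "?X \<union> ?Y \<noteq> {}" using S(2) by (auto, metis (full_types))
    qed (use V step in \<open>force+\<close>)
    have "?X \<inter> ?Y \<noteq> {}"
    proof
      assume disj: "?X \<inter> ?Y = {}"
      have "u \<in> ?X \<and> v \<in> ?Y \<or> u \<in> ?Y \<and> v \<in> ?X" if "(u, v) \<in> sarcs G" for u v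
      proof -
        have "u \<in> ?X \<union> ?Y" using that un signed_graphD(2)[OF G] by blast
        then show ?thesis using step[OF that, of False] step[OF that, of True] by auto
      qed
      then have "bipartite G" unfolding bipartite_def using un disj by blast
      with nb show False ..
    qed
    then have "?X \<inter> ?Y = sverts G"
      by (intro closed[THEN conjunct2, rule_format]) (use V step in \<open>force+\<close>)
    then have "(v, i) \<in> S" if "v \<in> sverts G" for v i using that by (cases i) auto
    then show ?thesis using S by (auto simp: sverts_bd)
  qed
  then show ?thesis
    unfolding connected_iff_closed[OF pg(2)] using closed by (auto simp: sverts_bd)
qed

section \<open>Common neighbours and triangles\<close>

lemma common_neighbours_altdef:
  assumes "signed_graph G"
  shows "common_neighbours G u v = {w. (u, w) \<in> sarcs G \<and> (v, w) \<in> sarcs G}"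
  using signed_graphD(2)[OF assms] by (auto simp: common_neighbours_def)

text \<open>Two vertices of one layer have only the common neighbours inherited from
  \<open>G\<close>, since each has just one neighbour in the other layer and these differ. For
  \<open>(u, i)\<close> and \<open>(v, j)\<close> in different layers the only candidates are
  \<open>(u, j)\<close> and \<open>(v, i)\<close>, and both qualify exactly when \<open>u\<close>
  and \<open>v\<close> are adjacent.\<close>

lemma card_common_neighbours_ltimes_K2:
  assumes rect: "signed_rectagraph G"
    and p: "p \<in> sverts (ltimes_K2 G)" and q: "q \<in> sverts (ltimes_K2 G)" and "p \<noteq> q"
  shows "card (common_neighbours (ltimes_K2 G) p q) \<in> {0, 2}"
proof -
  have G: "signed_graph G" using rect by (simp add: signed_rectagraph_def signed_02_graph_def)
  obtain u i v j where pq: "p = (u, i)" "q = (v, j)" by fastforce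
  have uv: "u \<in> sverts G" "v \<in> sverts G" using p q by (simp_all add: pq sverts_ltimes_K2)
  note cn = common_neighbours_altdef[OF signed_graph_ltimes_K2[OF G]] common_neighbours_altdef[OF G]
  note D = signed_graphD[OF G]
  show ?thesis
  proof (cases "i = j")
    case True
    then have "u \<noteq> v" using \<open>p \<noteq> q\<close> pq by simp
    with True have "common_neighbours (ltimes_K2 G) p q = common_neighbours G u v \<times> {i}"
      by (auto simp: cn pq sarcs_ltimes_K2)
    then show ?thesis
      using rect uv \<open>u \<noteq> v\<close>
      by (auto simp: signed_rectagraph_def signed_02_graph_def card_cartesian_product)
  next
    case False
    show ?thesis
    proof (cases "(u, v) \<in> sarcs G")
      case True
      then have "(v, u) \<in> sarcs G" "u \<noteq> v" using D(3,4) by auto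
      then have "common_neighbours (ltimes_K2 G) p q = {(u, j), (v, i)}"
        using True False uv D(4) by (auto simp: cn pq sarcs_ltimes_K2)
      then show ?thesis using \<open>u \<noteq> v\<close> by simp
    next
      \<comment> \<open>This includes \<open>u = v\<close>, as there are no loops.\<close>
      case nonadj: False
      then have "(v, u) \<notin> sarcs G" using D(3) by auto
      then have "common_neighbours (ltimes_K2 G) p q = {}"
        using nonadj False by (auto simp: cn pq sarcs_ltimes_K2)
      then show ?thesis by simp
    qed
  qed
qed

text \<open>Every arc changes the layer. Hence vertices of one layer share the neighbours they share
  in \<open>G\<close>, placed in the other layer, and vertices of different layers share
  none.\<close>

lemma card_common_neighbours_bd:
  assumes G: "signed_02_graph G"
    and p: "p \<in> sverts (bd G)" and q: "q \<in> sverts (bd G)" and "p \<noteq> q"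
  shows "card (common_neighbours (bd G) p q) \<in> {0, 2}"
proof -
  have sg: "signed_graph G" using G by (simp add: signed_02_graph_def)
  obtain u i v j where pq: "p = (u, i)" "q = (v, j)" by fastforce
  have uv: "u \<in> sverts G" "v \<in> sverts G" using p q by (simp_all add: pq sverts_bd)
  note cn = common_neighbours_altdef[OF signed_graph_bd[OF sg]] common_neighbours_altdef[OF sg]
  show ?thesis
  proof (cases "i = j")
    case True
    then have "u \<noteq> v" using \<open>p \<noteq> q\<close> pq by simp
    have "common_neighbours (bd G) p q = common_neighbours G u v \<times> {\<not> i}"
      using True by (auto simp: cn pq sarcs_bd)
    then show ?thesis
      using G uv \<open>u \<noteq> v\<close> by (auto simp: signed_02_graph_def card_cartesian_product)
  next
    case False
    then have "common_neighbours (bd G) p q = {}" by (auto simp: cn pq sarcs_bd)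
    then show ?thesis by simp
  qed
qed

lemma signed_rectagraph_ltimes_K2:
  assumes rect: "signed_rectagraph G"
  shows "signed_rectagraph (ltimes_K2 G)"
proof -
  have G: "signed_graph G" "Digraph_Component.connected (with_proj (base G))" "triangle_free G"
    using rect by (auto simp: signed_rectagraph_def signed_02_graph_def)
  \<comment> \<open>A closed walk changes layer an even number of times. A triangle with no change
    projects to a triangle of \<open>G\<close>; with two changes, its third arc projects to a
    loop.\<close>
  have "triangle_free (ltimes_K2 G)"
    unfolding triangle_free_def
  proof
    assume "\<exists>p q s. (p, q) \<in> sarcs (ltimes_K2 G) \<and> (q, s) \<in> sarcs (ltimes_K2 G) \<and>
      (s, p) \<in> sarcs (ltimes_K2 G)"
    then obtain u i v j w k where "((u, i), (v, j)) \<in> sarcs (ltimes_K2 G)"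
      "((v, j), (w, k)) \<in> sarcs (ltimes_K2 G)" "((w, k), (u, i)) \<in> sarcs (ltimes_K2 G)"
      by force
    then show False
      using G(3) signed_graphD(4)[OF G(1)] unfolding sarcs_ltimes_K2 triangle_free_def by metis
  qed
  then show ?thesis
    using signed_graph_ltimes_K2[OF G(1)] connected_ltimes_K2[OF G(1,2)]
      card_common_neighbours_ltimes_K2[OF rect]
    by (simp add: signed_rectagraph_def signed_02_graph_def)
qed

lemma signed_rectagraph_bd:
  assumes "signed_rectagraph G" and "\<not> bipartite G"
  shows "signed_rectagraph (bd G)"
proof -
  have G: "signed_graph G" "Digraph_Component.connected (with_proj (base G))" "signed_02_graph G"
    using assms by (auto simp: signed_rectagraph_def signed_02_graph_def)
  \<comment> \<open>A closed walk of odd length cannot change layer at every arc.\<close>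
  have "triangle_free (bd G)" by (auto simp: triangle_free_def sarcs_bd)
  then show ?thesis
    using signed_graph_bd[OF G(1)] connected_bd[OF G(1,2) assms(2)] card_common_neighbours_bd[OF G(3)]
    by (simp add: signed_rectagraph_def signed_02_graph_def)
qed

section \<open>Degrees in the constructions\<close>

lemma regular_altdef: "regular r G \<longleftrightarrow> (\<forall>v\<in>sverts G. card {w. (v, w) \<in> sarcs G} = r)"
  by (simp add: regular_def out_degree_with_proj)

lemma regular_ltimes_K2:
  assumes G: "signed_graph G" and reg: "regular r G"
  shows "regular (r + 1) (ltimes_K2 G)"
  unfolding regular_altdef
proof
  fix p assume p: "p \<in> sverts (ltimes_K2 G)"
  obtain u i where ui: "p = (u, i)" by fastforce
  have u: "u \<in> sverts G" using p by (simp add: ui sverts_ltimes_K2)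
  let ?N = "{w. (u, w) \<in> sarcs G}"
  have "finite ?N"
    by (rule finite_subset[OF _ signed_graphD(1)[OF G]]) (auto dest: signed_graphD(2)[OF G])
  moreover have "{q. (p, q) \<in> sarcs (ltimes_K2 G)} = insert (u, \<not> i) (?N \<times> {i})"
    using u by (auto simp: ui sarcs_ltimes_K2)
  ultimately show "card {q. (p, q) \<in> sarcs (ltimes_K2 G)} = r + 1"
    using reg u by (simp add: regular_altdef card_cartesian_product)
qed

lemma regular_bd:
  assumes reg: "regular r G"
  shows "regular r (bd G)"
  unfolding regular_altdef
proof
  fix p assume p: "p \<in> sverts (bd G)"
  obtain u i where ui: "p = (u, i)" by fastforce
  have "{q. (p, q) \<in> sarcs (bd G)} = {w. (u, w) \<in> sarcs G} \<times> {\<not> i}"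
    by (auto simp: ui sarcs_bd)
  then show "card {q. (p, q) \<in> sarcs (bd G)} = r"
    using reg p by (simp add: regular_altdef card_cartesian_product ui sverts_bd)
qed

section \<open>Spectra of the constructions\<close>

lemma sum_Times_bool:
  "(\<Sum>p\<in>V \<times> (UNIV :: bool set). f p) = (\<Sum>w\<in>V. f (w, False)) + (\<Sum>w\<in>V. f (w, True))"
proof -
  have "(\<Sum>p\<in>V \<times> (UNIV :: bool set). f p) = (\<Sum>w\<in>V. \<Sum>i\<in>UNIV. f (w, i))"
    by (simp add: sum.cartesian_product)
  then show ?thesis by (simp add: UNIV_bool sum.distrib)
qed

lemma sspectrum_ltimes_K2:
  assumes G: "signed_graph G" and ne: "sverts G \<noteq> {}" and spec: "sspectrum G = {l, - l}"
  shows "sspectrum (ltimes_K2 G) = {sqrt (l\<^sup>2 + 1), - sqrt (l\<^sup>2 + 1)}"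
proof (rule adj_square_imp_sspectrum)
  let ?V = "sverts G" and ?H = "ltimes_K2 G"
  have fin: "finite ?V" using signed_graphD(1)[OF G] .
  show "finite (sverts ?H)" "sverts ?H \<noteq> {}" using fin ne by (simp_all add: sverts_ltimes_K2)
  show "adj ?H p p = 0" for p using adj_diag[OF signed_graph_ltimes_K2[OF G]] .
  have pos: "0 < l\<^sup>2 + 1" by (simp add: add_nonneg_pos)
  then show "sqrt (l\<^sup>2 + 1) \<noteq> 0" by simp
  fix p q assume pq: "p \<in> sverts ?H" "q \<in> sverts ?H"
  obtain u i v j where e: "p = (u, i)" "q = (v, j)" by fastforce
  have uv: "u \<in> ?V" "v \<in> ?V" using pq by (simp_all add: e sverts_ltimes_K2)
  have sq: "(\<Sum>w\<in>?V. adj G u w * adj G w v) = (if u = v then l\<^sup>2 else 0)"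
    by (rule sspectrum_pm_imp_adj_square) (use fin adj_sym[OF G] spec uv in auto)
  \<comment> \<open>These sums are the products with the identity blocks.\<close>
  have delta: "(\<Sum>w\<in>?V. (if u = w then 1 else 0) * f w) = f u"
    "(\<Sum>w\<in>?V. f w * (if w = v then 1 else 0)) = f v" for f :: "'a \<Rightarrow> real"
    using fin uv by (simp_all add: if_distrib[where f = "\<lambda>x. _ * x"] if_distrib[where f = "\<lambda>x. x * _"]
      cong: if_cong)
  have "(\<Sum>s\<in>sverts ?H. adj ?H p s * adj ?H s q) =
      (\<Sum>w\<in>?V. adj ?H p (w, False) * adj ?H (w, False) q) +
      (\<Sum>w\<in>?V. adj ?H p (w, True) * adj ?H (w, True) q)"
    by (simp add: sverts_ltimes_K2 sum_Times_bool)
  \<comment> \<open>Equal layers give the entry of the squared adjacency matrix of \<open>G\<close>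
    plus that of the identity; different layers give \<open>adj G u v\<close> with both
    signs.\<close>
  also have "\<dots> = (if p = q then l\<^sup>2 + 1 else 0)"
    using uv by (cases i; cases j) (simp_all add: e adj_ltimes_K2 sq delta sum_negf cong: sum.cong)
  finally show "(\<Sum>s\<in>sverts ?H. adj ?H p s * adj ?H s q) = (if p = q then (sqrt (l\<^sup>2 + 1))\<^sup>2 else 0)"
    using pos by simp
qed

lemma sspectrum_bd:
  assumes G: "signed_graph G" and ne: "sverts G \<noteq> {}" and spec: "sspectrum G = {l, - l}"
    and l: "l \<noteq> 0"
  shows "sspectrum (bd G) = {l, - l}"
proof (rule adj_square_imp_sspectrum)
  let ?V = "sverts G" and ?H = "bd G"
  have fin: "finite ?V" using signed_graphD(1)[OF G] .
  show "finite (sverts ?H)" "sverts ?H \<noteq> {}" using fin ne by (simp_all add: sverts_bd)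
  show "adj ?H p p = 0" for p using adj_diag[OF signed_graph_bd[OF G]] .
  show "l \<noteq> 0" by fact
  fix p q assume pq: "p \<in> sverts ?H" "q \<in> sverts ?H"
  obtain u i v j where e: "p = (u, i)" "q = (v, j)" by fastforce
  have uv: "u \<in> ?V" "v \<in> ?V" using pq by (simp_all add: e sverts_bd)
  have "(\<Sum>w\<in>?V. adj G u w * adj G w v) = (if u = v then l\<^sup>2 else 0)"
    by (rule sspectrum_pm_imp_adj_square) (use fin adj_sym[OF G] spec uv in auto)
  \<comment> \<open>For equal layers only the summands over the opposite layer survive; for
    different layers each summand has a zero factor.\<close>
  then show "(\<Sum>s\<in>sverts ?H. adj ?H p s * adj ?H s q) = (if p = q then l\<^sup>2 else 0)"
    by (cases i; cases j) (simp_all add: e sverts_bd sum_Times_bool adj_bd)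
qed

section \<open>The bipartite double of a bipartite graph\<close>

lemma bipartite_bd_iso_two_copies:
  assumes G: "signed_graph G" and "bipartite G"
  shows "sg_iso (bd G) (two_copies G)"
proof -
  obtain X Y where disj: "X \<inter> Y = {}"
    and part: "\<forall>(u, v)\<in>sarcs G. u \<in> X \<and> v \<in> Y \<or> u \<in> Y \<and> v \<in> X"
    using \<open>bipartite G\<close> unfolding bipartite_def by (elim exE conjE)
  have XY: "u \<in> X \<longleftrightarrow> v \<notin> X" if "(u, v) \<in> sarcs G" for u v
    using disj bspec[OF part that] by auto
  \<comment> \<open>\<open>f\<close> keeps the layer over \<open>X\<close> and flips it elsewhere.
    The ends of an arc lie on opposite sides, so an arc changing layer becomes one inside a single
    copy. Signs depend only on the vertices of \<open>G\<close>, and \<open>f\<close> is its own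
    inverse.\<close>
  define f where "f = (\<lambda>(u, i). (u, i = (u \<in> X)))"
  have "bij_betw f (sverts (bd G)) (sverts (two_copies G))"
    by (rule bij_betwI[where g = f]) (auto simp: f_def bd_def two_copies_def)
  moreover have "((p, q) \<in> sarcs (bd G) \<longleftrightarrow> (f p, f q) \<in> sarcs (two_copies G)) \<and>
      ((p, q) \<in> sarcs (bd G) \<longrightarrow> sgn_of (two_copies G) (f p, f q) = sgn_of (bd G) (p, q))" for p q
  proof -
    obtain u i v j where e: "p = (u, i)" "q = (v, j)" by fastforce
    show ?thesis
    proof (cases "(u, v) \<in> sarcs G")
      case True
      from XY[OF this] show ?thesis
        by (cases "v \<in> X"; cases i; cases j) (simp_all add: e f_def bd_def two_copies_def True)
    qed (simp add: e f_def bd_def two_copies_def)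
  qed
  ultimately show ?thesis unfolding sg_iso_def by blast
qed

theorem theorem3p8:
  fixes G :: "'a signed_graph" and n r :: nat
  assumes "nr_SR2SE n r G"
  shows "nr_SR2SE (2 * n) (r + 1) (ltimes_K2 G) \<and>
    (\<not> bipartite G \<longrightarrow> nr_SR2SE (2 * n) r (bd G)) \<and>
    (bipartite G \<longrightarrow> sg_iso (bd G) (two_copies G))"
proof (intro conjI impI)
  obtain l where l: "l \<noteq> - l" "sspectrum G = {l, - l}" and rect: "signed_rectagraph G"
    and n: "card (sverts G) = n" and reg: "regular r G"
    using assms by (auto simp: nr_SR2SE_def SR2SE_def)
  have G: "signed_graph G" "Digraph_Component.connected (with_proj (base G))"
    using rect by (auto simp: signed_rectagraph_def signed_02_graph_def)
  \<comment> \<open>Connectedness includes having at least one vertex.\<close>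
  then have ne: "sverts G \<noteq> {}"
    by (auto simp: signed_graph_def connected_iff_closed)
  have "0 < sqrt (l\<^sup>2 + 1)" by (simp add: add_nonneg_pos)
  then have "sqrt (l\<^sup>2 + 1) \<noteq> - sqrt (l\<^sup>2 + 1)" by linarith
  with sspectrum_ltimes_K2[OF G(1) ne l(2)]
  have "\<exists>m. m \<noteq> - m \<and> sspectrum (ltimes_K2 G) = {m, - m}" by blast
  then show "nr_SR2SE (2 * n) (r + 1) (ltimes_K2 G)"
    using signed_rectagraph_ltimes_K2[OF rect] regular_ltimes_K2[OF G(1) reg] n
    by (simp add: nr_SR2SE_def SR2SE_def sverts_ltimes_K2 card_cartesian_product)
  show "nr_SR2SE (2 * n) r (bd G)" if "\<not> bipartite G"
  proof -
    have "sspectrum (bd G) = {l, - l}" by (rule sspectrum_bd[OF G(1) ne l(2)]) (use l(1) in auto)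
    with l(1) have "\<exists>m. m \<noteq> - m \<and> sspectrum (bd G) = {m, - m}" by blast
    then show ?thesis
      using signed_rectagraph_bd[OF rect that] regular_bd[OF reg] n
      by (simp add: nr_SR2SE_def SR2SE_def sverts_bd card_cartesian_product)
  qed
  show "sg_iso (bd G) (two_copies G)" if "bipartite G"
    using bipartite_bd_iso_two_copies[OF G(1) that] .
qed

end
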